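(* Let $G$ be a path on $n\ge 2$ vertices $v_1,\ldots,v_n$ (with $v_j$ adjacent to $v_{j+1}$), with $\mathbf{v}_{\mathrm{out}}=v_1$ and $\mathbf{v}_{\mathrm{in}}=v_n$. For $\mathbf{r}\in\mathbb{R}^{V(G)}$, the equation $\tau_\rho=\mathbf{r}$ is solvable if and only if $\mathbf{r}\in\Psi_G$.
   Context: For a weight function $\rho:V(G)\to(0,\infty)$, the $\rho$-walk is the random walk $(w_0,w_1,\ldots)$ with $w_0=\mathbf{v}_{\mathrm{in}}$ which from $x$ moves to a neighbor $y$ with probability $\rho(y)/\sum_{z\in N(x)}\rho(z)$ ($N(x)$ the set of neighbors of $x$), stopped at the first time $T$ with $w_T=\mathbf{v}_{\mathrm{out}}$; $\tau_\rho(x)$ is the expected number of indices $0\le j\le T$ with $w_j=x$. "$\tau_\rho=\mathbf{r}$ is solvable" means there exists $\rho$ with all values strictly positive such that $\tau_\rho=\mathbf{r}$. A proper walk is a walk $\omega=(w_0=\mathbf{v}_{\mathrm{in}},\ldots,w_T=\mathbf{v}_{\mathrm{out}})$ in $G$ (consecutive vertices adjacent) with $w_j\neq\mathbf{v}_{\mathrm{out}}$ for $j<T$; its trace is $\mathrm{tr}_\omega(x)=|\{j:0\le j\le T,\ w_j=x\}|$. $\Psi_G$ is the relative interior (interior relative to the affine hull) of the convex hull of the traces of all proper walks. *)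

theory Defs
  imports "HOL-Probability.Probability"
begin

text \<open>A graph is given by its adjacency relation on a finite vertex type \<open>'v\<close>, so that
  \<open>real ^ 'v\<close> is the space of real vectors indexed by the vertices.\<close>

definition nbrs :: "('v \<Rightarrow> 'v \<Rightarrow> bool) \<Rightarrow> 'v \<Rightarrow> 'v set" where
  "nbrs adj x = {y. adj x y}"

definition is_path_graph :: "('v \<Rightarrow> 'v \<Rightarrow> bool) \<Rightarrow> (nat \<Rightarrow> 'v) \<Rightarrow> nat \<Rightarrow> bool" where
  "is_path_graph adj v n \<longleftrightarrow> bij_betw v {1..n} UNIV \<and>
     (\<forall>x y. adj x y \<longleftrightarrow>
        (\<exists>j\<in>{1..<n}. (x = v j \<and> y = v (Suc j)) \<or> (x = v (Suc j) \<and> y = v j)))"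

text \<open>\<open>embed_pmf\<close> is meaningful here whenever \<open>\<rho>\<close> is positive and \<open>x\<close> has a neighbour;
  see \<open>pmf_rho_step\<close> below.\<close>

definition rho_step :: "('v::finite \<Rightarrow> 'v \<Rightarrow> bool) \<Rightarrow> ('v \<Rightarrow> real) \<Rightarrow> 'v \<Rightarrow> 'v pmf" where
  "rho_step adj \<rho> x =
     embed_pmf (\<lambda>y. if y \<in> nbrs adj x then \<rho> y / (\<Sum>z\<in>nbrs adj x. \<rho> z) else 0)"

text \<open>The conditional law of \<open>w\<^sub>i\<close> given \<open>w\<^sub>0, \<dots>, w\<^bsub>i-1\<^esub>\<close>, and the resulting
  Ionescu-Tulcea measure on infinite trajectories.  The trajectories run on after reaching the
  target vertex; stopping is taken into account in \<open>visits\<close>.\<close>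

definition rho_kernel ::
    "('v::finite \<Rightarrow> 'v \<Rightarrow> bool) \<Rightarrow> 'v \<Rightarrow> ('v \<Rightarrow> real) \<Rightarrow> nat \<Rightarrow> (nat \<Rightarrow> 'v) \<Rightarrow> 'v measure" where
  "rho_kernel adj vin \<rho> i \<omega> =
     measure_pmf (case i of 0 \<Rightarrow> return_pmf vin | Suc k \<Rightarrow> rho_step adj \<rho> (\<omega> k))"

definition rho_walk ::
    "('v::finite \<Rightarrow> 'v \<Rightarrow> bool) \<Rightarrow> 'v \<Rightarrow> ('v \<Rightarrow> real) \<Rightarrow> (nat \<Rightarrow> 'v) measure" where
  "rho_walk adj vin \<rho> =
     projective_family.lim UNIV
       (Ionescu_Tulcea.CI (rho_kernel adj vin \<rho>) (\<lambda>_. count_space UNIV))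
       (\<lambda>_. count_space UNIV)"

text \<open>The stopping time is \<open>\<infinity>\<close> if the target is never reached.\<close>

definition stop_time :: "'v \<Rightarrow> (nat \<Rightarrow> 'v) \<Rightarrow> enat" where
  "stop_time vout w = (INF j\<in>{j. w j = vout}. enat j)"

definition visits :: "'v \<Rightarrow> 'v \<Rightarrow> (nat \<Rightarrow> 'v) \<Rightarrow> ennreal" where
  "visits vout x w = emeasure (count_space UNIV) {j. enat j \<le> stop_time vout w \<and> w j = x}"

definition tau ::
    "('v::finite \<Rightarrow> 'v \<Rightarrow> bool) \<Rightarrow> 'v \<Rightarrow> 'v \<Rightarrow> ('v \<Rightarrow> real) \<Rightarrow> 'v \<Rightarrow> ennreal" where
  "tau adj vin vout \<rho> x = (\<integral>\<^sup>+ w. visits vout x w \<partial>rho_walk adj vin \<rho>)"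

text \<open>The comparison takes place in \<open>ereal\<close>: \<open>ennreal\<close> and \<open>enn2real\<close> would send negative
  and infinite values to \<open>0\<close>, respectively.\<close>

definition solvable ::
    "('v::finite \<Rightarrow> 'v \<Rightarrow> bool) \<Rightarrow> 'v \<Rightarrow> 'v \<Rightarrow> real ^ 'v \<Rightarrow> bool" where
  "solvable adj vin vout r \<longleftrightarrow>
     (\<exists>\<rho>. (\<forall>x. 0 < \<rho> x) \<and> (\<forall>x. enn2ereal (tau adj vin vout \<rho> x) = ereal (r $ x)))"

definition proper_walk :: "('v \<Rightarrow> 'v \<Rightarrow> bool) \<Rightarrow> 'v \<Rightarrow> 'v \<Rightarrow> 'v list \<Rightarrow> bool" where
  "proper_walk adj vin vout w \<longleftrightarrow>
     w \<noteq> [] \<and> hd w = vin \<and> last w = vout \<and> successively adj w \<and> vout \<notin> set (butlast w)"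

definition walk_trace :: "'v list \<Rightarrow> real ^ 'v::finite" where
  "walk_trace w = (\<chi> x. real (card {j. j < length w \<and> w ! j = x}))"

definition Psi :: "('v::finite \<Rightarrow> 'v \<Rightarrow> bool) \<Rightarrow> 'v \<Rightarrow> 'v \<Rightarrow> (real ^ 'v) set" where
  "Psi adj vin vout =
     rel_interior (convex hull (walk_trace ` {w. proper_walk adj vin vout w}))"

lemma pmf_rho_step:
  assumes "\<And>x. 0 < \<rho> x" and "nbrs adj x \<noteq> {}"
  shows "pmf (rho_step adj \<rho> x) y =
           (if adj x y then \<rho> y / (\<Sum>z\<in>nbrs adj x. \<rho> z) else 0)"
proof -
  let ?f = "\<lambda>y. if y \<in> nbrs adj x then \<rho> y / (\<Sum>z\<in>nbrs adj x. \<rho> z) else 0"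
  have S: "0 < (\<Sum>z\<in>nbrs adj x. \<rho> z)"
    using assms by (intro sum_pos) auto
  have nonneg: "\<And>y. 0 \<le> ?f y"
    using S assms(1) by (auto intro!: divide_nonneg_pos less_imp_le)
  have "(\<Sum>y\<in>UNIV. ?f y) = (\<Sum>y\<in>nbrs adj x. \<rho> y / (\<Sum>z\<in>nbrs adj x. \<rho> z))"
    by (simp add: sum.If_cases)
  also have "\<dots> = 1"
    using S by (simp add: sum_divide_distrib[symmetric])
  finally have "(\<integral>\<^sup>+ y. ennreal (?f y) \<partial>count_space UNIV) = 1"
    using nonneg by (subst nn_integral_count_space_finite) (simp_all add: sum_ennreal)
  with nonneg have "pmf (rho_step adj \<rho> x) y = ?f y"
    unfolding rho_step_def by (intro pmf_embed_pmf) auto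
  then show ?thesis
    by (simp add: nbrs_def)
qed

lemma Ionescu_Tulcea_rho_kernel:
  "Ionescu_Tulcea (rho_kernel adj vin \<rho>) (\<lambda>_. count_space UNIV)"
proof (rule Ionescu_Tulcea.intro)
  fix i :: nat
  show "rho_kernel adj vin \<rho> i \<in>
      measurable (PiM {0..<i} (\<lambda>_. count_space UNIV)) (subprob_algebra (count_space UNIV))"
  proof (cases i)
    case 0
    then show ?thesis
      by (simp add: rho_kernel_def[abs_def] measure_pmf_in_subprob_space space_subprob_algebra)
  next
    case (Suc k)
    have "(\<lambda>\<omega>. \<omega> k) \<in> measurable (PiM {0..<i} (\<lambda>_. count_space UNIV)) (count_space (UNIV :: 'a set))"
      using Suc by (intro measurable_component_singleton) auto
    moreover have "(\<lambda>x. measure_pmf (rho_step adj \<rho> x)) \<in>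
        measurable (count_space UNIV) (subprob_algebra (count_space UNIV))"
      by (auto simp: measure_pmf_in_subprob_algebra)
    ultimately show ?thesis
      using Suc measurable_compose by (fastforce simp: rho_kernel_def[abs_def])
  qed
next
  fix i :: nat and \<omega> :: "nat \<Rightarrow> 'a"
  show "prob_space (rho_kernel adj vin \<rho> i \<omega>)"
    by (simp add: rho_kernel_def measure_pmf.prob_space_axioms)
qed

lemma rho_walk_cylinder:
  "emeasure (rho_walk adj vin \<rho>) {w. \<forall>i\<le>n. w i = p i} =
     ennreal (indicator {vin} (p 0) * (\<Prod>i<n. pmf (rho_step adj \<rho> (p i)) (p (Suc i))))"
proof -
  let ?M = "\<lambda>_::nat. count_space (UNIV :: 'a set)"
  interpret IT: Ionescu_Tulcea "rho_kernel adj vin \<rho>" ?M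
    by (rule Ionescu_Tulcea_rho_kernel)
  let ?u = "\<lambda>_::nat. undefined :: 'a"
  have u: "?u \<in> space (PiM {0..<0} ?M)"
    by (simp add: space_PiM)
  define E where "E m = {restrict p {0..<m}}" for m
  have E_PiE: "E m = PiE {0..<m} (\<lambda>i. {p i})" for m
    unfolding E_def by (auto simp: PiE_iff extensional_def restrict_def fun_eq_iff)
  have E_sets[measurable]: "E m \<in> sets (PiM {0..<m} ?M)" for m
    unfolding E_PiE by (intro sets_PiM_I_finite) auto
  define q where "q m = (case m of 0 \<Rightarrow> indicator {vin} (p 0) | Suc k \<Rightarrow> pmf (rho_step adj \<rho> (p k)) (p m))"
    for m :: nat
  have q0: "0 \<le> q m" for m
    by (auto simp: q_def split: nat.split)
  have step: "emeasure (IT.eP m \<omega>) (E (Suc m)) = ennreal (q m) * indicator (E m) \<omega>"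
    if "\<omega> \<in> space (PiM {0..<m} ?M)" for m \<omega>
  proof -
    have ext: "\<omega> \<in> extensional {0..<m}"
      using that by (simp add: space_PiM PiE_iff)
    have *: "fun_upd \<omega> m x \<in> E (Suc m) \<longleftrightarrow> x = p m \<and> \<omega> \<in> E m" for x
      using ext unfolding E_PiE
      by (auto simp: PiE_iff extensional_def less_Suc_eq split: if_splits)
    have "(\<lambda>x. fun_upd \<omega> m x) -` E (Suc m) = (if \<omega> \<in> E m then {p m} else {})"
      using * by auto
    moreover have "emeasure (rho_kernel adj vin \<rho> m \<omega>) {p m} = ennreal (q m)" if "\<omega> \<in> E m"
      using that
      by (cases m) (auto simp: rho_kernel_def q_def emeasure_pmf_single E_def indicator_def pmf_return)
    ultimately show ?thesis
      using that by (simp add: IT.emeasure_eP)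
  qed
  have C: "emeasure (IT.C 0 m ?u) (E m) = ennreal (\<Prod>i<m. q i)" for m
  proof (induction m)
    case 0
    have "?u \<in> E 0"
      by (auto simp: E_def restrict_def)
    then show ?case
      using E_sets[of 0] by simp
  next
    case (Suc m)
    have "emeasure (IT.C 0 (Suc m) ?u) (E (Suc m)) =
        (\<integral>\<^sup>+ \<omega>. emeasure (IT.eP m \<omega>) (E (Suc m)) \<partial>IT.C 0 m ?u)"
      using IT.measurable_eP[of m] IT.sets_C[OF u, of m] IT.space_C[OF u, of m]
      by (simp, subst emeasure_bind[where N = "PiM {0..<Suc m} ?M"])
         (auto simp: space_PiM_empty_iff cong: measurable_cong_sets)
    also have "\<dots> = (\<integral>\<^sup>+ \<omega>. ennreal (q m) * indicator (E m) \<omega> \<partial>IT.C 0 m ?u)"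
      using IT.space_C[OF u, of m] by (intro nn_integral_cong step) simp
    also have "\<dots> = ennreal (q m) * emeasure (IT.C 0 m ?u) (E m)"
      using IT.sets_C[OF u, of m] by (subst nn_integral_cmult_indicator) auto
    finally show ?case
      using Suc q0 by (simp add: ennreal_mult'' prod_nonneg mult.commute)
  qed
  have "{w. \<forall>i\<le>n. w i = p i} = IT.PF.emb UNIV {0..<Suc n} (E (Suc n))"
    unfolding E_PiE by (auto simp: prod_emb_def PiE_iff space_PiM less_Suc_eq_le)
  then have "emeasure (rho_walk adj vin \<rho>) {w. \<forall>i\<le>n. w i = p i} = emeasure (IT.CI {0..<Suc n}) (E (Suc n))"
    unfolding rho_walk_def by (simp only:) (rule IT.lim, auto)
  also have "\<dots> = emeasure (IT.C 0 (Suc n) ?u) (E (Suc n))"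
    using sets.sets_into_space[OF E_sets[of "Suc n"]]
    by (subst IT.emeasure_CI[where n = "Suc n"]) (auto simp: prod_emb_id space_PiM)
  also have "\<dots> = ennreal (\<Prod>i<Suc n. q i)"
    by (rule C)
  also have "(\<Prod>i<Suc n. q i) =
      indicator {vin} (p 0) * (\<Prod>i<n. pmf (rho_step adj \<rho> (p i)) (p (Suc i)))"
    by (subst prod.lessThan_Suc_shift) (simp add: q_def)
  finally show ?thesis .
qed

end

theory Submission
  imports Defs
begin

text \<open>
  A walk from \<open>v n\<close> to \<open>v 1\<close> crosses every edge downwards once more often than upwards, so its
  visits are determined by the numbers \<open>U j\<close> of upward crossings of the edges: \<open>v j\<close> is visited
  \<open>1 + U (j - 1) + U j\<close> times, where \<open>U\<close> vanishes outside \<open>{2..<n}\<close>.  For proper walks, \<open>U\<close> is an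
  arbitrary vector of natural numbers, so \<open>\<Psi>\<close> is the image of the positive orthant.  For the
  weighted walk, the expected crossings satisfy \<open>U j / (1 + U (j - 1)) = \<rho> (v (j + 1)) / \<rho> (v (j - 1))\<close>;
  these ratios can be prescribed independently, so \<open>U\<close> is an arbitrary positive vector.
\<close>

section \<open>Expected visits of a stopped Markov chain\<close>

lemma sets_rho_walk: "sets (rho_walk adj vin \<rho>) = sets (PiM UNIV (\<lambda>_. count_space UNIV))"
proof -
  interpret IT: Ionescu_Tulcea "rho_kernel adj vin \<rho>" "\<lambda>_. count_space UNIV"
    by (rule Ionescu_Tulcea_rho_kernel)
  show ?thesis
    unfolding rho_walk_def by simp
qed

lemma space_rho_walk: "space (rho_walk adj vin \<rho>) = UNIV"
  using sets_eq_imp_space_eq[OF sets_rho_walk] by (simp add: space_PiM)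

lemma measurable_rho_walk_component [measurable]:
  "(\<lambda>w. w i) \<in> measurable (rho_walk adj vin \<rho>) (count_space UNIV)"
  by (subst measurable_cong_sets[OF sets_rho_walk refl]) (rule measurable_component_singleton, simp)

text \<open>The event that the stopped walk is at \<open>x\<close> at time \<open>k\<close>. Only
  times before \<open>k\<close> must avoid \<open>vout\<close>, so the visit at the stopping time
  itself is counted, as in \<open>visits\<close>.\<close>

definition arrivals :: "'v \<Rightarrow> nat \<Rightarrow> 'v \<Rightarrow> (nat \<Rightarrow> 'v) set" where
  "arrivals vout k x = {w. w k = x \<and> (\<forall>j<k. w j \<noteq> vout)}"

lemma sets_arrivals [measurable]: "arrivals vout k x \<in> sets (rho_walk adj vin \<rho>)"
proof -
  have "{w \<in> space (rho_walk adj vin \<rho>). w k = x \<and> (\<forall>j<k. w j \<noteq> vout)} \<in> sets (rho_walk adj vin \<rho>)"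
    by measurable
  then show ?thesis
    by (simp add: space_rho_walk arrivals_def)
qed

lemma le_stop_time_iff: "enat k \<le> stop_time vout w \<longleftrightarrow> (\<forall>j<k. w j \<noteq> vout)"
  unfolding stop_time_def le_INF_iff using not_le by auto

lemma visits_eq_suminf: "visits vout x w = (\<Sum>k. indicator (arrivals vout k x) w)"
proof -
  have "visits vout x w = (\<integral>\<^sup>+ k. indicator {j. enat j \<le> stop_time vout w \<and> w j = x} k \<partial>count_space UNIV)"
    unfolding visits_def by (subst nn_integral_indicator) auto
  also have "\<dots> = (\<Sum>k. indicator {j. enat j \<le> stop_time vout w \<and> w j = x} k)"
    by (rule nn_integral_count_space_nat)
  also have "\<dots> = (\<Sum>k. indicator (arrivals vout k x) w)"
    by (intro suminf_cong) (auto simp: indicator_def arrivals_def le_stop_time_iff)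
  finally show ?thesis .
qed

lemma tau_eq_suminf:
  "tau adj vin vout \<rho> x = (\<Sum>k. emeasure (rho_walk adj vin \<rho>) (arrivals vout k x))"
  unfolding tau_def visits_eq_suminf by (subst nn_integral_suminf) auto

lemma emeasure_arrivals_0:
  "emeasure (rho_walk adj vin \<rho>) (arrivals vout 0 y) = indicator {vin} y"
  using rho_walk_cylinder[of adj vin \<rho> 0 "\<lambda>_. y"]
  by (simp add: arrivals_def indicator_def)

text \<open>Markov property for a single initial segment: the product formulas for segments ending
  at times \<open>k\<close> and \<open>Suc k\<close> differ by one factor.\<close>

lemma emeasure_cylinder_step:
  "emeasure (rho_walk adj vin \<rho>) {w. (\<forall>i\<le>k. w i = p i) \<and> w (Suc k) = y} =
   emeasure (rho_walk adj vin \<rho>) {w. \<forall>i\<le>k. w i = p i} * ennreal (pmf (rho_step adj \<rho> (p k)) y)"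
proof -
  have "{w. (\<forall>i\<le>k. w i = p i) \<and> w (Suc k) = y} = {w. \<forall>i\<le>Suc k. w i = (p(Suc k := y)) i}"
    by (auto simp: le_Suc_eq)
  moreover have "(\<Prod>i<k. pmf (rho_step adj \<rho> ((p(Suc k := y)) i)) ((p(Suc k := y)) (Suc i))) =
      (\<Prod>i<k. pmf (rho_step adj \<rho> (p i)) (p (Suc i)))"
    by (intro prod.cong) auto
  ultimately show ?thesis
    by (simp only: rho_walk_cylinder prod.lessThan_Suc)
       (simp add: ennreal_mult'' mult.assoc[symmetric])
qed

text \<open>Markov property at time \<open>k\<close>: the event \<open>arrivals vout k x\<close>
  depends only on the coordinates up to \<open>k\<close>, so it splits into finitely many cylinders
  ending at \<open>x\<close>, and each contributes the same transition factor.\<close>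

lemma emeasure_arrivals_step:
  "emeasure (rho_walk adj vin \<rho>) {w \<in> arrivals vout k x. w (Suc k) = y} =
   emeasure (rho_walk adj vin \<rho>) (arrivals vout k x) * ennreal (pmf (rho_step adj \<rho> x) y)"
proof -
  let ?M = "rho_walk adj vin \<rho>"
  \<comment> \<open>Initial segments are encoded as extensional functions on \<open>{..k}\<close>;
    this makes \<open>P\<close> finite and gives distinct segments disjoint cylinders.\<close>
  define P where "P = {p \<in> PiE {..k} (\<lambda>_. UNIV :: 'a set). p k = x \<and> (\<forall>j<k. p j \<noteq> vout)}"
  define C where "C p = {w. \<forall>i\<le>k. w i = p i}" for p :: "nat \<Rightarrow> 'a"
  define D where "D p = {w. (\<forall>i\<le>k. w i = p i) \<and> w (Suc k) = y}" for p :: "nat \<Rightarrow> 'a"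
  have finP: "finite P"
    unfolding P_def by (rule finite_subset[OF _ finite_PiE[of "{..k}" "\<lambda>_. UNIV"]]) auto
  have measC: "C p \<in> sets ?M" and measD: "D p \<in> sets ?M" for p
  proof -
    have "{w \<in> space ?M. \<forall>i\<le>k. w i = p i} \<in> sets ?M"
      "{w \<in> space ?M. (\<forall>i\<le>k. w i = p i) \<and> w (Suc k) = y} \<in> sets ?M"
      by measurable
    then show "C p \<in> sets ?M" "D p \<in> sets ?M"
      by (simp_all add: C_def D_def space_rho_walk)
  qed
  have restr: "restrict w {..k} \<in> P" if "w \<in> arrivals vout k x" for w
    using that by (auto simp: P_def arrivals_def)
  have arrC: "arrivals vout k x = (\<Union>p\<in>P. C p)"
  proof (intro equalityI subsetI)
    fix w assume "w \<in> arrivals vout k x"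
    then show "w \<in> (\<Union>p\<in>P. C p)"
      using restr by (intro UN_I[of "restrict w {..k}"]) (auto simp: C_def)
  qed (auto simp: P_def C_def arrivals_def)
  have arrD: "{w \<in> arrivals vout k x. w (Suc k) = y} = (\<Union>p\<in>P. D p)"
    unfolding arrC by (auto simp: C_def D_def)
  have uniq: "p = p'" if "p \<in> P" "p' \<in> P" "w \<in> C p" "w \<in> C p'" for p p' w
    using that unfolding P_def C_def by (intro PiE_ext[of p "{..k}" "\<lambda>_. UNIV"]) auto
  have disC: "disjoint_family_on C P"
    using uniq by (auto simp: disjoint_family_on_def)
  have disD: "disjoint_family_on D P"
    using uniq by (fastforce simp: disjoint_family_on_def C_def D_def)
  have "emeasure ?M (\<Union>p\<in>P. D p) = (\<Sum>p\<in>P. emeasure ?M (D p))"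
    using measD disD finP by (intro sum_emeasure[symmetric]) auto
  also have "\<dots> = (\<Sum>p\<in>P. emeasure ?M (C p) * ennreal (pmf (rho_step adj \<rho> x) y))"
    unfolding C_def D_def by (intro sum.cong) (auto simp: emeasure_cylinder_step P_def)
  also have "\<dots> = (\<Sum>p\<in>P. emeasure ?M (C p)) * ennreal (pmf (rho_step adj \<rho> x) y)"
    by (simp add: sum_distrib_right)
  also have "(\<Sum>p\<in>P. emeasure ?M (C p)) = emeasure ?M (\<Union>p\<in>P. C p)"
    using measC disC finP by (intro sum_emeasure) auto
  finally show ?thesis
    unfolding arrC[symmetric] arrD[symmetric] .
qed

lemma emeasure_arrivals_Suc:
  "emeasure (rho_walk adj vin \<rho>) (arrivals vout (Suc k) y) =
   (\<Sum>x\<in>- {vout}. emeasure (rho_walk adj vin \<rho>) (arrivals vout k x) *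
      ennreal (pmf (rho_step adj \<rho> x) y))"
proof -
  let ?M = "rho_walk adj vin \<rho>"
  let ?E = "\<lambda>x. {w \<in> arrivals vout k x. w (Suc k) = y}"
  have meas: "?E x \<in> sets ?M" for x
  proof -
    have "{w \<in> space ?M. w \<in> arrivals vout k x \<and> w (Suc k) = y} \<in> sets ?M"
      by measurable
    then show ?thesis by (simp add: space_rho_walk)
  qed
  have "arrivals vout (Suc k) y = (\<Union>x\<in>- {vout}. ?E x)"
    by (auto simp: arrivals_def less_Suc_eq)
  also have "emeasure ?M \<dots> = (\<Sum>x\<in>- {vout}. emeasure ?M (?E x))"
    using meas by (intro sum_emeasure[symmetric]) (auto simp: disjoint_family_on_def arrivals_def)
  finally show ?thesis
    by (simp add: emeasure_arrivals_step)
qed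

text \<open>The one-step recursion for arrivals, summed over all times. Everything stays in
  \<open>ennreal\<close>, so finiteness of \<open>tau\<close> is not presupposed.\<close>

lemma tau_step:
  "tau adj vin vout \<rho> y = indicator {vin} y +
     (\<Sum>x\<in>- {vout}. tau adj vin vout \<rho> x * ennreal (pmf (rho_step adj \<rho> x) y))"
proof -
  let ?f = "\<lambda>k x. emeasure (rho_walk adj vin \<rho>) (arrivals vout k x)"
  have "tau adj vin vout \<rho> y = ?f 0 y + (\<Sum>k. ?f (Suc k) y)"
    unfolding tau_eq_suminf using suminf_offset[of "\<lambda>k. ?f k y" 1]
    by (simp add: add.commute)
  also have "(\<Sum>k. ?f (Suc k) y) =
      (\<Sum>x\<in>- {vout}. \<Sum>k. ?f k x * ennreal (pmf (rho_step adj \<rho> x) y))"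
    unfolding emeasure_arrivals_Suc by (rule suminf_sum) simp
  also have "\<dots> = (\<Sum>x\<in>- {vout}. tau adj vin vout \<rho> x * ennreal (pmf (rho_step adj \<rho> x) y))"
    unfolding tau_eq_suminf by (simp add: ennreal_suminf_multc)
  finally show ?thesis
    by (simp add: emeasure_arrivals_0)
qed

text \<open>Minimality of the Green function: the sum over the first \<open>m\<close> times obeys
  the same recursion with \<open>m\<close> lowered by one, so induction keeps it below any
  supersolution. This is the source of finiteness of \<open>tau\<close>.\<close>

lemma tau_le_supersolution:
  fixes h :: "'v::finite \<Rightarrow> ennreal"
  assumes "\<And>y. indicator {vin} y +
      (\<Sum>x\<in>- {vout}. h x * ennreal (pmf (rho_step adj \<rho> x) y)) \<le> h y"
  shows "tau adj vin vout \<rho> y \<le> h y"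
proof -
  let ?f = "\<lambda>k x. emeasure (rho_walk adj vin \<rho>) (arrivals vout k x)"
  have "(\<Sum>k<m. ?f k y) \<le> h y" for m
  proof (induction m arbitrary: y)
    case (Suc m)
    have "(\<Sum>k<Suc m. ?f k y) = indicator {vin} y +
        (\<Sum>k<m. \<Sum>x\<in>- {vout}. ?f k x * ennreal (pmf (rho_step adj \<rho> x) y))"
      by (simp only: sum.lessThan_Suc_shift emeasure_arrivals_0 emeasure_arrivals_Suc)
    also have "\<dots> = indicator {vin} y +
        (\<Sum>x\<in>- {vout}. (\<Sum>k<m. ?f k x) * ennreal (pmf (rho_step adj \<rho> x) y))"
      by (subst sum.swap) (simp add: sum_distrib_right)
    also have "\<dots> \<le> indicator {vin} y +
        (\<Sum>x\<in>- {vout}. h x * ennreal (pmf (rho_step adj \<rho> x) y))"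
      by (intro add_left_mono sum_mono mult_right_mono Suc) simp
    finally show ?case
      using assms[of y] by (rule order_trans)
  qed simp
  then show ?thesis
    unfolding tau_eq_suminf by (intro suminf_le_const) auto
qed

section \<open>Crossing numbers on a path\<close>

locale path_graph =
  fixes adj :: "'v::finite \<Rightarrow> 'v \<Rightarrow> bool" and v :: "nat \<Rightarrow> 'v" and n :: nat
  assumes n: "n \<ge> 2" and path: "is_path_graph adj v n"
begin

definition idx :: "'v \<Rightarrow> nat" where
  "idx = the_inv_into {1..n} v"

lemma bij: "bij_betw v {1..n} UNIV"
  using path by (simp add: is_path_graph_def)

lemma idx_v [simp]: "1 \<le> j \<Longrightarrow> j \<le> n \<Longrightarrow> idx (v j) = j"
  using bij unfolding idx_def by (intro the_inv_into_f_f) (auto simp: bij_betw_def)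

lemma vertex_cases:
  obtains j where "x = v j" "1 \<le> j" "j \<le> n"
proof -
  have "x \<in> v ` {1..n}" using bij by (simp add: bij_betw_def)
  then show ?thesis using that by auto
qed

lemma v_eq_iff: "1 \<le> i \<Longrightarrow> i \<le> n \<Longrightarrow> 1 \<le> j \<Longrightarrow> j \<le> n \<Longrightarrow> v i = v j \<longleftrightarrow> i = j"
  by (metis idx_v)

lemma adj_iff:
  assumes "1 \<le> i" "i \<le> n" "1 \<le> j" "j \<le> n"
  shows "adj (v i) (v j) \<longleftrightarrow> j = Suc i \<or> i = Suc j"
proof -
  have "adj (v i) (v j) \<longleftrightarrow> (\<exists>k\<in>{1..<n}. (v i = v k \<and> v j = v (Suc k)) \<or> (v i = v (Suc k) \<and> v j = v k))"
    using path by (simp add: is_path_graph_def)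
  also have "\<dots> \<longleftrightarrow> (\<exists>k\<in>{1..<n}. (i = k \<and> j = Suc k) \<or> (i = Suc k \<and> j = k))"
    using assms by (intro bex_cong refl) (auto simp: v_eq_iff)
  also have "\<dots> \<longleftrightarrow> j = Suc i \<or> i = Suc j"
    using assms by auto
  finally show ?thesis .
qed

text \<open>\<open>U j\<close> belongs to the edge between \<open>v j\<close> and
  \<open>v (Suc j)\<close>. Since \<open>idx x\<close> is at least 1, the subtraction does not
  truncate; at \<open>v 1\<close> it reads \<open>U 0\<close>.\<close>

definition visit_vec :: "(nat \<Rightarrow> real) \<Rightarrow> real ^ 'v" where
  "visit_vec U = (\<chi> x. 1 + U (idx x - 1) + U (idx x))"

text \<open>Edge 1 is excluded because a walk stops at \<open>v 1\<close> and never leaves it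
  upwards. The indices 0 and \<open>n\<close> are not edges; the value 0 there makes the visit
  formula uniform at both ends.\<close>

definition crossings :: "(nat \<Rightarrow> real) set" where
  "crossings = {U. (\<forall>j\<in>{2..<n}. 0 \<le> U j) \<and> (\<forall>j. j \<notin> {2..<n} \<longrightarrow> U j = 0)}"

definition pos_crossings :: "(nat \<Rightarrow> real) set" where
  "pos_crossings = {U. (\<forall>j\<in>{2..<n}. 0 < U j) \<and> (\<forall>j. j \<notin> {2..<n} \<longrightarrow> U j = 0)}"

lemma visit_vec_nth [simp]: "1 \<le> j \<Longrightarrow> j \<le> n \<Longrightarrow> visit_vec U $ v j = 1 + U (j - 1) + U j"
  by (simp add: visit_vec_def)

lemma vec_eq_path_iff: "a = b \<longleftrightarrow> (\<forall>j. 1 \<le> j \<and> j \<le> n \<longrightarrow> a $ v j = b $ v j)"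
  for a b :: "'a ^ 'v"
  by (metis vec_eq_iff vertex_cases)

text \<open>The constant term 1 survives because the coefficients sum to 1. Their signs are free, so
  segments can also be prolonged beyond an end point.\<close>

lemma visit_vec_affine:
  "s + t = 1 \<Longrightarrow> s *\<^sub>R visit_vec A + t *\<^sub>R visit_vec B = visit_vec (\<lambda>j. s * A j + t * B j)"
  by (simp add: vec_eq_iff visit_vec_def distrib_left)

section \<open>Traces of proper walks\<close>

lemma walk_trace_nth: "walk_trace w $ x = real (count_list w x)"
  by (simp add: walk_trace_def count_list_eq_length_filter length_filter_conv_card eq_commute)

text \<open>The start is an arbitrary \<open>v k\<close> to allow induction on the walk: only the
  edges below \<open>v k\<close> have a net downward crossing, and each vertex up to
  \<open>v k\<close> gets its 1 from this.\<close>

lemma count_list_walk_to_endpoint: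
  assumes "w \<noteq> []" "hd w = v k" "1 \<le> k" "k \<le> n" "last w = v 1" "successively adj w"
    and "v 1 \<notin> set (butlast w)"
  shows "\<exists>U :: nat \<Rightarrow> nat. (\<forall>j. j \<notin> {2..<n} \<longrightarrow> U j = 0) \<and>
    (\<forall>j. 1 \<le> j \<and> j \<le> n \<longrightarrow> count_list w (v j) = (if j \<le> k then 1 else 0) + U (j - 1) + U j)"
  using assms
proof (induction w arbitrary: k)
  case (Cons a w)
  show ?case
  proof (cases "w = []")
    case True
    then have "k = 1" using Cons.prems n by (simp add: v_eq_iff)
    then show ?thesis
      using True Cons.prems n by (intro exI[of _ "\<lambda>_. 0"]) (auto simp: v_eq_iff)
  next
    case False
    obtain m where m: "hd w = v m" "1 \<le> m" "m \<le> n"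
      by (rule vertex_cases)
    have a: "a = v k" using Cons.prems by simp
    have "a \<noteq> v 1" using Cons.prems False by auto
    \<comment> \<open>An upward first step from \<open>v k\<close> thus never uses edge 1, so
      \<open>U\<close> may be changed at \<open>k\<close> without leaving the support
      \<open>{2..<n}\<close>.\<close>
    then have k: "k \<ge> 2" using a Cons.prems(3) by (cases "k = 1") auto
    have "adj a (hd w)" and suc: "successively adj w"
      using Cons.prems(6) False by (cases w; auto)+
    then have km: "m = Suc k \<or> k = Suc m"
      using a m Cons.prems by (simp add: adj_iff)
    obtain U where U: "\<forall>j. j \<notin> {2..<n} \<longrightarrow> U j = 0"
      "\<forall>j. 1 \<le> j \<and> j \<le> n \<longrightarrow> count_list w (v j) = (if j \<le> m then 1 else 0) + U (j - 1) + U j"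
      using Cons.IH[OF False m] suc Cons.prems False by auto
    from km show ?thesis
    proof
      assume "k = Suc m"
      then show ?thesis
        using U a Cons.prems by (intro exI[of _ U]) (auto simp: v_eq_iff)
    next
      \<comment> \<open>The first step crosses edge \<open>k\<close> upwards. At \<open>v k\<close>
        the extra crossing accounts for the new visit; at \<open>v (Suc k)\<close> it replaces the 1
        lost when the start moves from \<open>Suc k\<close> to \<open>k\<close>.\<close>
      assume mk: "m = Suc k"
      show ?thesis
        using U a mk k m Cons.prems(3,4)
        by (intro exI[of _ "U(k := Suc (U k))"]) (auto simp: v_eq_iff)
    qed
  qed
qed simp

lemma walk_trace_in_crossings:
  assumes "proper_walk adj (v n) (v 1) w"
  shows "walk_trace w \<in> visit_vec ` crossings"
proof -
  obtain U :: "nat \<Rightarrow> nat" where U: "\<forall>j. j \<notin> {2..<n} \<longrightarrow> U j = 0"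
    "\<forall>j. 1 \<le> j \<and> j \<le> n \<longrightarrow> count_list w (v j) = (if j \<le> n then 1 else 0) + U (j - 1) + U j"
    using count_list_walk_to_endpoint[of w n] assms n by (auto simp: proper_walk_def)
  then have "walk_trace w = visit_vec (\<lambda>j. real (U j))"
    by (simp add: vec_eq_path_iff walk_trace_nth)
  moreover have "(\<lambda>j. real (U j)) \<in> crossings"
    using U by (simp add: crossings_def)
  ultimately show ?thesis by blast
qed

section \<open>Proper walks with prescribed crossing numbers\<close>

definition bounces :: "(nat \<Rightarrow> nat) \<Rightarrow> nat \<Rightarrow> 'v list" where
  "bounces u j = v j # concat (replicate (u j) [v (Suc j), v j])"

text \<open>A walk realizing the crossing numbers \<open>u\<close>: on its way down it pauses at
  each \<open>v j\<close> for \<open>u j\<close> excursions to \<open>v (Suc j)\<close> and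
  back.\<close>

fun descent :: "(nat \<Rightarrow> nat) \<Rightarrow> nat \<Rightarrow> 'v list" where
  "descent u 0 = []"
| "descent u (Suc k) = bounces u (Suc k) @ descent u k"

lemma bounces_props:
  assumes "1 \<le> j" "j \<le> n" "u j = 0 \<or> j < n"
  shows "bounces u j \<noteq> [] \<and> hd (bounces u j) = v j \<and> last (bounces u j) = v j \<and>
    successively adj (bounces u j)"
proof -
  have "last (v j # concat (replicate m [v (Suc j), v j])) = v j \<and>
    successively adj (v j # concat (replicate m [v (Suc j), v j]))" if "m = 0 \<or> j < n" for m
    using that by (induction m) (use assms in \<open>auto simp: adj_iff\<close>)
  from this[of "u j"] show ?thesis using assms by (auto simp: bounces_def)
qed

lemma set_bounces: "set (bounces u j) \<subseteq> {v j, v (Suc j)}"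
  by (auto simp: bounces_def)

lemma count_list_concat_replicate: "count_list (concat (replicate m xs)) x = m * count_list xs x"
  by (induction m) auto

lemma descent_props:
  assumes "\<And>j. j \<notin> {2..<n} \<Longrightarrow> u j = 0" "k \<le> n"
  shows "k \<ge> 1 \<Longrightarrow> descent u k \<noteq> [] \<and> hd (descent u k) = v k \<and> last (descent u k) = v 1 \<and>
    successively adj (descent u k) \<and> v 1 \<notin> set (butlast (descent u k))"
  using assms(2)
proof (induction k)
  case (Suc k)
  show ?case
  proof (cases "k = 0")
    case True
    then show ?thesis using assms(1)[of 1] by (simp add: bounces_def)
  next
    case False
    then have IH: "descent u k \<noteq> []" "hd (descent u k) = v k" "last (descent u k) = v 1"
      "successively adj (descent u k)" "v 1 \<notin> set (butlast (descent u k))"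
      using Suc by auto
    have uk: "u (Suc k) = 0 \<or> Suc k < n"
      using assms(1)[of "Suc k"] by auto
    have B: "bounces u (Suc k) \<noteq> []" "hd (bounces u (Suc k)) = v (Suc k)"
      "last (bounces u (Suc k)) = v (Suc k)" "successively adj (bounces u (Suc k))"
      using bounces_props[of "Suc k" u] Suc.prems(2) uk by auto
    \<comment> \<open>If there are excursions, \<open>Suc (Suc k)\<close> is at most
      \<open>n\<close>, where \<open>v\<close> is injective. Beyond \<open>n\<close> the map
      \<open>v\<close> is unconstrained and might return \<open>v 1\<close>.\<close>
    have "v 1 \<notin> set (bounces u (Suc k))"
    proof (cases "u (Suc k) = 0")
      case True
      then show ?thesis using False Suc.prems by (simp add: bounces_def v_eq_iff)
    next
      case F: False
      then have "Suc (Suc k) \<le> n" using uk by simp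
      then have "v 1 \<noteq> v (Suc k)" "v 1 \<noteq> v (Suc (Suc k))"
        using False by (subst v_eq_iff; simp)+
      then show ?thesis using set_bounces[of u "Suc k"] by auto
    qed
    moreover have "adj (v (Suc k)) (v k)"
      using False Suc.prems by (simp add: adj_iff)
    ultimately show ?thesis
      using IH B by (auto simp: successively_append_iff butlast_append)
  qed
qed simp

text \<open>\<open>v j\<close> is met \<open>1 + u j\<close> times while pausing at
  \<open>v j\<close> and \<open>u (j - 1)\<close> times in the excursions from below. A descent from
  \<open>v k\<close> already contains the latter for \<open>j = Suc k\<close>, hence the two
  different bounds.\<close>

lemma count_list_descent:
  assumes "\<And>j. j \<notin> {2..<n} \<Longrightarrow> u j = 0" "k \<le> n" "1 \<le> j" "j \<le> n"
  shows "count_list (descent u k) (v j) =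
    (if j \<le> k then 1 + u j else 0) + (if j \<le> Suc k then u (j - 1) else 0)"
  using assms(2)
proof (induction k)
  case 0
  show ?case using assms(1)[of 0] assms(3) by auto
next
  case (Suc k)
  have "count_list (bounces u (Suc k)) (v j) =
     (if j = Suc k then 1 + u j else 0) + (if j = Suc (Suc k) then u (j - 1) else 0)"
  proof (cases "Suc k = n")
    case True
    then have "u (Suc k) = 0" using assms(1) by simp
    then show ?thesis using assms(3,4) True by (simp add: bounces_def v_eq_iff)
  next
    case False
    then show ?thesis
      using assms(3,4) Suc.prems
      by (auto simp: bounces_def v_eq_iff count_list_concat_replicate)
  qed
  then show ?case using Suc by auto
qed

lemma visit_vec_in_traces:
  assumes "\<And>j. j \<notin> {2..<n} \<Longrightarrow> u j = 0"
  shows "visit_vec (\<lambda>j. real (u j)) \<in> walk_trace ` {w. proper_walk adj (v n) (v 1) w}"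
proof -
  have "proper_walk adj (v n) (v 1) (descent u n)"
    using descent_props[of u n] assms n by (simp add: proper_walk_def)
  moreover have "visit_vec (\<lambda>j. real (u j)) = walk_trace (descent u n)"
    using count_list_descent[of u n] assms by (simp add: vec_eq_path_iff walk_trace_nth)
  ultimately show ?thesis by blast
qed

section \<open>The convex hull of the traces and its relative interior\<close>

lemma convex_visit_vec_crossings: "convex (visit_vec ` crossings)"
proof (rule convexI)
  fix x y :: "real ^ 'v" and s t :: real
  assume "x \<in> visit_vec ` crossings" "y \<in> visit_vec ` crossings" and st: "0 \<le> s" "0 \<le> t" "s + t = 1"
  then obtain A B where "A \<in> crossings" "B \<in> crossings" "x = visit_vec A" "y = visit_vec B"
    by blast
  then show "s *\<^sub>R x + t *\<^sub>R y \<in> visit_vec ` crossings"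
    using st by (auto simp: visit_vec_affine crossings_def intro!: imageI)
qed

lemma crossings_in_convex_hull:
  assumes U: "U \<in> crossings"
  shows "visit_vec U \<in> convex hull (walk_trace ` {w. proper_walk adj (v n) (v 1) w})"
    (is "_ \<in> convex hull ?W")
proof -
  \<comment> \<open>\<open>N\<close> exceeds the sum of all coordinates, so the weight left for the
    vector 0 is nonnegative.\<close>
  obtain N :: nat where N: "(\<Sum>j\<in>{2..<n}. U j) < real N" "0 < N"
    using reals_Archimedean2[of "max 0 (\<Sum>j\<in>{2..<n}. U j)"] by auto
  \<comment> \<open>\<open>U\<close> is a convex combination of \<open>0\<close> (index \<open>0\<close>) and the vectors with single entry \<open>N\<close> at \<open>j\<close>.\<close>
  define a where "a j = (if j = 0 then 1 - (\<Sum>j\<in>{2..<n}. U j) / N else U j / N)" for j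
  define e where "e i j = (if j = i \<and> j \<in> {2..<n} then N else 0)" for i j :: nat
  let ?I = "insert 0 {2..<n}"
  have U0: "U j \<ge> 0" for j using U by (cases "j \<in> {2..<n}") (auto simp: crossings_def)
  have "(\<Sum>i\<in>?I. a i *\<^sub>R visit_vec (\<lambda>j. real (e i j))) \<in> convex hull ?W"
  proof (rule convex_sum)
    show "(\<Sum>i\<in>?I. a i) = 1"
      by (simp add: a_def sum_divide_distrib)
    show "visit_vec (\<lambda>j. real (e i j)) \<in> convex hull ?W" if "i \<in> ?I" for i
      by (intro hull_inc visit_vec_in_traces) (auto simp: e_def)
    show "0 \<le> a i" if "i \<in> ?I" for i
      using N U0 by (auto simp: a_def)
  qed (auto)
  also have "(\<Sum>i\<in>?I. a i *\<^sub>R visit_vec (\<lambda>j. real (e i j))) = visit_vec U"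
  proof -
    have sum_a: "(\<Sum>i\<in>?I. a i) = 1"
      by (simp add: a_def sum_divide_distrib)
    have *: "(\<Sum>i\<in>?I. a i * real (e i j)) = U j" for j
    proof -
      have "(\<Sum>i\<in>?I. a i * real (e i j)) = (\<Sum>i\<in>?I. if i = j then U j else 0)"
        using N U by (intro sum.cong) (auto simp: a_def e_def crossings_def)
      then show ?thesis using U by (auto simp: crossings_def)
    qed
    have "(\<Sum>i\<in>?I. a i *\<^sub>R visit_vec (\<lambda>j. real (e i j))) $ v j = visit_vec U $ v j"
      if "1 \<le> j" "j \<le> n" for j
    proof -
      have "(\<Sum>i\<in>?I. a i *\<^sub>R visit_vec (\<lambda>j. real (e i j))) $ v j =
        (\<Sum>i\<in>?I. a i + a i * real (e i (j - 1)) + a i * real (e i j))"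
        unfolding sum_component using that by (intro sum.cong) (auto simp: distrib_left)
      also have "\<dots> = 1 + U (j - 1) + U j"
        unfolding sum.distrib * sum_a ..
      finally show ?thesis using that by simp
    qed
    then show ?thesis by (simp add: vec_eq_path_iff)
  qed
  finally show ?thesis .
qed

lemma convex_hull_traces:
  "convex hull (walk_trace ` {w. proper_walk adj (v n) (v 1) w}) = visit_vec ` crossings"
proof (intro equalityI)
  show "convex hull (walk_trace ` {w. proper_walk adj (v n) (v 1) w}) \<subseteq> visit_vec ` crossings"
    using convex_visit_vec_crossings walk_trace_in_crossings by (intro hull_minimal) auto
qed (use crossings_in_convex_hull in auto)

text \<open>A point of a nonempty convex set is in its relative interior iff every segment to it
  from a point of the set can be prolonged within the set. This test avoids computing the affine
  hull.\<close>

lemma Psi_path: "Psi adj (v n) (v 1) = visit_vec ` pos_crossings"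
proof -
  have ne: "visit_vec ` crossings \<noteq> {}"
    by (auto simp: crossings_def intro: exI[of _ "\<lambda>_. 0"])
  have "z \<in> rel_interior (visit_vec ` crossings) \<longleftrightarrow> z \<in> visit_vec ` pos_crossings" for z
  proof -
    have "(\<forall>x\<in>visit_vec ` crossings. \<exists>e>1. (1 - e) *\<^sub>R x + e *\<^sub>R z \<in> visit_vec ` crossings) \<longleftrightarrow>
      z \<in> visit_vec ` pos_crossings" (is "?L \<longleftrightarrow> ?R")
    proof
      assume ?L
      \<comment> \<open>Prolonging the segment from a point with all inner coordinates positive
        writes \<open>z\<close> as a convex combination giving that point positive weight, so the
        inner coordinates of \<open>z\<close> are positive as well.\<close>
      define O1 :: "nat \<Rightarrow> real" where "O1 j = (if j \<in> {2..<n} then 1 else 0)" for j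
      have "O1 \<in> crossings" by (simp add: O1_def crossings_def)
      then obtain e A where e: "e > 1" "A \<in> crossings" "(1 - e) *\<^sub>R visit_vec O1 + e *\<^sub>R z = visit_vec A"
        using \<open>?L\<close> by (force elim!: imageE)
      have "z = (1 / e) *\<^sub>R visit_vec A + ((e - 1) / e) *\<^sub>R visit_vec O1"
        using e(1) unfolding e(3)[symmetric] by (simp add: vec_eq_iff field_simps)
      also have "\<dots> = visit_vec (\<lambda>j. (1 / e) * A j + ((e - 1) / e) * O1 j)"
        using e(1) by (intro visit_vec_affine) (simp add: field_simps)
      finally have "z = visit_vec (\<lambda>j. (1 / e) * A j + ((e - 1) / e) * O1 j)" .
      moreover have "(\<lambda>j. (1 / e) * A j + ((e - 1) / e) * O1 j) \<in> pos_crossings"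
        using e(1,2) by (auto simp: pos_crossings_def crossings_def O1_def intro!: add_nonneg_pos)
      ultimately show ?R by blast
    next
      assume ?R
      then obtain U where U: "U \<in> pos_crossings" "z = visit_vec U" by blast
      show ?L
      proof
        fix x assume "x \<in> visit_vec ` crossings"
        then obtain A where A: "A \<in> crossings" "x = visit_vec A" by blast
        \<comment> \<open>The prolonged point has coordinates \<open>U j + d * (U j - A j)\<close>,
          which are nonnegative once \<open>d * A j \<le> U j\<close>. The least \<open>U j\<close>
          divided by an upper bound of all \<open>A j\<close> serves as \<open>d\<close>; for
          \<open>n = 2\<close> there are no inner coordinates and any \<open>d\<close>
          works.\<close>
        have "\<exists>d>0. \<forall>j\<in>{2..<n}. d * A j \<le> U j"
        proof (cases "n > 2")
          case True
          define m where "m = Min (U ` {2..<n})"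
          define K where "K = 1 + (\<Sum>j\<in>{2..<n}. A j)"
          have Apos: "\<forall>j\<in>{2..<n}. 0 \<le> A j" using A by (simp add: crossings_def)
          then have K: "K \<ge> 1" using sum_nonneg[of "{2..<n}" A] by (simp add: K_def)
          have m: "m > 0" "\<forall>j\<in>{2..<n}. m \<le> U j"
            using True U by (auto simp: m_def pos_crossings_def)
          have "m / K * A j \<le> U j" if j: "j \<in> {2..<n}" for j
          proof -
            have "A j \<le> K"
              using member_le_sum[of j "{2..<n}" A] Apos j by (auto simp: K_def)
            then have "m * A j \<le> m * K" using m by simp
            then have "m / K * A j \<le> m" using K by (simp add: field_simps)
            also have "m \<le> U j" using m j by blast
            finally show ?thesis .
          qed
          then show ?thesis using m K by (intro exI[of _ "m / K"]) auto
        qed (auto intro: exI[of _ 1])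
        then obtain d where d: "d > 0" "\<forall>j\<in>{2..<n}. d * A j \<le> U j" by blast
        have "(1 - (1 + d)) *\<^sub>R x + (1 + d) *\<^sub>R z = visit_vec (\<lambda>j. (1 - (1 + d)) * A j + (1 + d) * U j)"
          unfolding A U by (rule visit_vec_affine) simp
        moreover have "(\<lambda>j. (1 - (1 + d)) * A j + (1 + d) * U j) \<in> crossings"
        proof -
          have "0 \<le> (1 - (1 + d)) * A j + (1 + d) * U j" if j: "j \<in> {2..<n}" for j
          proof -
            have "0 \<le> d * U j" using d U j by (simp add: pos_crossings_def less_imp_le)
            moreover have "d * A j \<le> U j" using d j by blast
            ultimately show ?thesis by (simp add: algebra_simps)
          qed
          then show ?thesis using A U by (auto simp: crossings_def pos_crossings_def)
        qed
        ultimately show "\<exists>e>1. (1 - e) *\<^sub>R x + e *\<^sub>R z \<in> visit_vec ` crossings"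
          using d by (intro exI[of _ "1 + d"]) auto
      qed
    qed
    then show ?thesis
      using convex_rel_interior_iff[OF convex_visit_vec_crossings ne] by simp
  qed
  then show ?thesis
    unfolding Psi_def convex_hull_traces by blast
qed

section \<open>Visits of the weighted walk\<close>

lemma ennreal_add3:
  "0 \<le> a \<Longrightarrow> 0 \<le> b \<Longrightarrow> 0 \<le> c \<Longrightarrow> ennreal a + (ennreal b + ennreal c) = ennreal (a + (b + c))"
  by simp

lemma nbrs_inner: "2 \<le> j \<Longrightarrow> j < n \<Longrightarrow> nbrs adj (v j) = {v (j - 1), v (Suc j)}"
proof (intro set_eqI)
  fix x assume "2 \<le> j" "j < n"
  then show "x \<in> nbrs adj (v j) \<longleftrightarrow> x \<in> {v (j - 1), v (Suc j)}"
    by (cases x rule: vertex_cases) (auto simp: nbrs_def adj_iff v_eq_iff)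
qed

lemma nbrs_last: "nbrs adj (v n) = {v (n - 1)}"
proof (intro set_eqI)
  fix x show "x \<in> nbrs adj (v n) \<longleftrightarrow> x \<in> {v (n - 1)}"
    using n by (cases x rule: vertex_cases) (auto simp: nbrs_def adj_iff v_eq_iff)
qed

context
  fixes \<rho> :: "'v \<Rightarrow> real"
  assumes \<rho>: "\<And>x. 0 < \<rho> x"
begin

text \<open>The default 0 is the true value at \<open>v n\<close>, whose only neighbour is below; at
  \<open>v 1\<close> it expresses that the stopped walk does not go up again.\<close>

definition up_prob :: "nat \<Rightarrow> real" where
  "up_prob j = (if 2 \<le> j \<and> j < n then \<rho> (v (Suc j)) / (\<rho> (v (j - 1)) + \<rho> (v (Suc j))) else 0)"

lemma up_prob_bounds: "0 \<le> up_prob j" "up_prob j < 1"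
  using \<rho> by (auto simp: up_prob_def less_imp_le add_pos_pos field_simps)

lemma up_prob_pos: "2 \<le> j \<Longrightarrow> j < n \<Longrightarrow> 0 < up_prob j"
  using \<rho> by (auto simp: up_prob_def add_pos_pos)

lemma up_prob_balance:
  "2 \<le> j \<Longrightarrow> j < n \<Longrightarrow> up_prob j * \<rho> (v (j - 1)) = (1 - up_prob j) * \<rho> (v (Suc j))"
  using add_pos_pos[OF \<rho>[of "v (j - 1)"] \<rho>[of "v (Suc j)"]]
  by (simp add: up_prob_def field_simps)

lemma pmf_rho_step_path:
  assumes "2 \<le> j" "j \<le> n" "1 \<le> i" "i \<le> n"
  shows "pmf (rho_step adj \<rho> (v j)) (v i) =
    (if i = Suc j then up_prob j else if j = Suc i then 1 - up_prob j else 0)"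
proof (cases "j = n")
  case True
  have "pmf (rho_step adj \<rho> (v n)) (v i) = (if adj (v n) (v i) then \<rho> (v i) / \<rho> (v (n - 1)) else 0)"
    by (subst pmf_rho_step[OF \<rho>]) (simp_all add: nbrs_last)
  also have "\<dots> = (if n = Suc i then 1 else 0)"
    using assms \<rho>[of "v i"] by (auto simp: adj_iff)
  moreover have "up_prob n = 0"
    by (simp add: up_prob_def)
  ultimately show ?thesis
    using True assms by auto
next
  case False
  then have j: "2 \<le> j" "j < n" using assms by auto
  have "v (j - 1) \<noteq> v (Suc j)" using j by (subst v_eq_iff) auto
  then have "pmf (rho_step adj \<rho> (v j)) (v i) =
      (if i = Suc j \<or> j = Suc i then \<rho> (v i) / (\<rho> (v (j - 1)) + \<rho> (v (Suc j))) else 0)"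
    using assms j by (subst pmf_rho_step[OF \<rho>]) (simp_all add: nbrs_inner adj_iff)
  moreover have "1 - up_prob j = \<rho> (v (j - 1)) / (\<rho> (v (j - 1)) + \<rho> (v (Suc j)))"
    using j add_pos_pos[OF \<rho>[of "v (j - 1)"] \<rho>[of "v (Suc j)"]]
    by (simp add: up_prob_def divide_simps)
  moreover have "up_prob j = \<rho> (v (Suc j)) / (\<rho> (v (j - 1)) + \<rho> (v (Suc j)))"
    using j by (simp add: up_prob_def)
  ultimately show ?thesis
    by auto
qed

text \<open>The bound \<open>3 \<le> i\<close> arises because \<open>v 1\<close> emits nothing: a
  neighbour below \<open>v i\<close> contributes only if its index is at least 2.\<close>

lemma sum_inflow_path:
  fixes G :: "'v \<Rightarrow> ennreal"
  assumes i: "1 \<le> i" "i \<le> n"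
  shows "(\<Sum>x\<in>- {v 1}. G x * ennreal (pmf (rho_step adj \<rho> x) (v i))) =
    (if 3 \<le> i then G (v (i - 1)) * ennreal (up_prob (i - 1)) else 0) +
    (if i < n then G (v (Suc i)) * ennreal (1 - up_prob (Suc i)) else 0)"
proof -
  have "bij_betw v {2..n} (- {v 1})"
  proof (rule bij_betw_imageI)
    show "inj_on v {2..n}" by (auto simp: inj_on_def v_eq_iff)
    show "v ` {2..n} = - {v 1}"
    proof (intro equalityI subsetI)
      fix x assume "x \<in> - {v 1}"
      moreover obtain j where j: "x = v j" "1 \<le> j" "j \<le> n" by (rule vertex_cases)
      ultimately have "j \<noteq> 1" by auto
      then show "x \<in> v ` {2..n}" using j by auto
    qed (use n in \<open>auto simp: v_eq_iff\<close>)
  qed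
  then have "(\<Sum>x\<in>- {v 1}. G x * ennreal (pmf (rho_step adj \<rho> x) (v i))) =
      (\<Sum>j\<in>{2..n}. G (v j) * ennreal (pmf (rho_step adj \<rho> (v j)) (v i)))"
    by (rule sum.reindex_bij_betw[symmetric])
  also have "\<dots> = (\<Sum>j\<in>{2..n}. (if j = i - 1 then G (v (i - 1)) * ennreal (up_prob (i - 1)) else 0) +
      (if j = Suc i then G (v (Suc i)) * ennreal (1 - up_prob (Suc i)) else 0))"
    using i by (intro sum.cong) (auto simp: pmf_rho_step_path)
  also have "\<dots> = (if 3 \<le> i then G (v (i - 1)) * ennreal (up_prob (i - 1)) else 0) +
      (if i < n then G (v (Suc i)) * ennreal (1 - up_prob (Suc i)) else 0)"
    using i by (auto simp: sum.distrib)
  finally show ?thesis .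
qed

text \<open>Across each edge the expected net flow is one step downwards; with \<open>tau\<close> finite, the balance
  equations therefore determine it from the top vertex on.\<close>

lemma tau_path_eq_visit_vec:
  fixes g :: "nat \<Rightarrow> real"
  assumes g: "\<And>j. 1 \<le> j \<Longrightarrow> j \<le> n \<Longrightarrow> tau adj (v n) (v 1) \<rho> (v j) = ennreal (g j)"
    and g0: "\<And>j. 1 \<le> j \<Longrightarrow> j \<le> n \<Longrightarrow> 0 \<le> g j"
  obtains U where "U \<in> pos_crossings"
    and "\<And>j. 1 \<le> j \<Longrightarrow> j \<le> n \<Longrightarrow> g j = 1 + U (j - 1) + U j"
    and "\<And>j. 2 \<le> j \<Longrightarrow> j < n \<Longrightarrow> U j * \<rho> (v (j - 1)) = (1 + U (j - 1)) * \<rho> (v (Suc j))"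
proof -
  \<comment> \<open>Expected visits to \<open>v j\<close> times the probability of then going up:
    the expected number of upward crossings of edge \<open>j\<close>.\<close>
  define U where "U j = g j * up_prob j" for j
  have U0: "U j = 0" if "j \<notin> {2..<n}" for j
    using that by (auto simp: U_def up_prob_def)
  have bal: "g i = (if i = n then 1 else 0) + U (i - 1) +
      (if i < n then g (Suc i) * (1 - up_prob (Suc i)) else 0)" if i: "1 \<le> i" "i \<le> n" for i
  proof -
    have up: "(if 3 \<le> i then tau adj (v n) (v 1) \<rho> (v (i - 1)) * ennreal (up_prob (i - 1)) else 0) =
        ennreal (U (i - 1))"
      using i g[of "i - 1"] up_prob_bounds[of "i - 1"] g0[of "i - 1"] U0[of "i - 1"]
      by (auto simp: U_def ennreal_mult'')
    have down: "(if i < n then tau adj (v n) (v 1) \<rho> (v (Suc i)) * ennreal (1 - up_prob (Suc i)) else 0) =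
        ennreal (if i < n then g (Suc i) * (1 - up_prob (Suc i)) else 0)"
      using i g[of "Suc i"] up_prob_bounds[of "Suc i"] by (auto simp: ennreal_mult'')
    have U_nonneg: "0 \<le> U (i - 1)"
      using i U0[of "i - 1"] g0[of "i - 1"] up_prob_bounds[of "i - 1"]
      by (cases "i = 1") (auto simp: U_def)
    have down_nonneg: "0 \<le> (if i < n then g (Suc i) * (1 - up_prob (Suc i)) else 0)"
      using i g0[of "Suc i"] up_prob_bounds[of "Suc i"] by auto
    have "ennreal (g i) = indicator {v n} (v i) + (ennreal (U (i - 1)) +
        ennreal (if i < n then g (Suc i) * (1 - up_prob (Suc i)) else 0))"
      using tau_step[of adj "v n" "v 1" \<rho> "v i"]
      unfolding sum_inflow_path[OF i] up down g[OF i] .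
    also have "indicator {v n} (v i) = ennreal (if i = n then 1 else 0)"
      using i n by (auto simp: v_eq_iff)
    also have "ennreal (if i = n then 1 else 0) + (ennreal (U (i - 1)) +
        ennreal (if i < n then g (Suc i) * (1 - up_prob (Suc i)) else 0)) =
        ennreal ((if i = n then 1 else 0) + (U (i - 1) +
          (if i < n then g (Suc i) * (1 - up_prob (Suc i)) else 0)))"
      using U_nonneg down_nonneg by (intro ennreal_add3) auto
    finally have "g i = (if i = n then 1 else 0) + (U (i - 1) +
          (if i < n then g (Suc i) * (1 - up_prob (Suc i)) else 0))"
      using g0[OF i] U_nonneg down_nonneg by (subst (asm) ennreal_inj) auto
    then show ?thesis by simp
  qed
  \<comment> \<open>The left side is the expected number of downward crossings of edge
    \<open>i\<close>. At \<open>v n\<close> the start supplies the 1; \<open>bal\<close> then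
    carries the net flow down from edge to edge.\<close>
  have net: "g (Suc i) * (1 - up_prob (Suc i)) = 1 + U i" if "1 \<le> i" "i \<le> n - 1" for i
    using that(2,1)
  proof (induction rule: inc_induct)
    case base
    then show ?case using bal[of n] n by (simp add: up_prob_def)
  next
    case (step i)
    then have "g (Suc i) = U i + g (Suc (Suc i)) * (1 - up_prob (Suc (Suc i)))"
      using bal[of "Suc i"] by auto
    also have "\<dots> = U i + (1 + U (Suc i))"
      using step by simp
    finally have "g (Suc i) - U (Suc i) = 1 + U i"
      by simp
    then show ?case
      by (simp add: U_def algebra_simps)
  qed
  have gU: "g j = 1 + U (j - 1) + U j" if "1 \<le> j" "j \<le> n" for j
    using bal[OF that] net[of j] U0[of n] that by (cases "j = n") auto
  \<comment> \<open>By \<open>gU\<close>, \<open>v j\<close> is visited at least once on average,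
    and from there the walk goes up with positive probability.\<close>
  have pos: "U j > 0" if j: "2 \<le> j" "j < n" for j
  proof -
    have "0 \<le> U (j - 1)" "0 \<le> U j"
      using g0[of j] g0[of "j - 1"] up_prob_bounds j by (auto simp: U_def)
    then have "g j > 0" using gU[of j] j by auto
    then show ?thesis using up_prob_pos[OF j] by (simp add: U_def)
  qed
  show ?thesis
  proof (rule that)
    show "U \<in> pos_crossings" using pos U0 by (auto simp: pos_crossings_def)
    show "U j * \<rho> (v (j - 1)) = (1 + U (j - 1)) * \<rho> (v (Suc j))" if j: "2 \<le> j" "j < n" for j
    proof -
      have "U j * \<rho> (v (j - 1)) = g j * (1 - up_prob j) * \<rho> (v (Suc j))"
        using up_prob_balance[OF j] by (simp add: U_def)
      also have "g j * (1 - up_prob j) = 1 + U (j - 1)"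
        using net[of "j - 1"] j by simp
      finally show ?thesis .
    qed
  qed (use gU in auto)
qed

text \<open>\<open>visit_vec U\<close> solves the balance equations with equality, so it bounds
  their least solution \<open>tau\<close>. The purpose is finiteness; equality comes from
  \<open>tau_path_eq_visit_vec\<close>.\<close>

lemma tau_path_le_visit_vec:
  assumes U: "U \<in> pos_crossings"
    and rat: "\<And>j. 2 \<le> j \<Longrightarrow> j < n \<Longrightarrow> U j * \<rho> (v (j - 1)) = (1 + U (j - 1)) * \<rho> (v (Suc j))"
  shows "tau adj (v n) (v 1) \<rho> x \<le> ennreal (visit_vec U $ x)"
proof (rule tau_le_supersolution)
  fix y
  obtain i where i: "y = v i" "1 \<le> i" "i \<le> n" by (rule vertex_cases)
  have U0: "0 \<le> U j" for j
    using U by (cases "j \<in> {2..<n}") (auto simp: pos_crossings_def less_imp_le)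
  have Uz: "U j = 0" if "j \<notin> {2..<n}" for j
    using U that by (auto simp: pos_crossings_def)
  have up: "(1 + U (j - 1) + U j) * up_prob j = U j" for j
  proof (cases "2 \<le> j \<and> j < n")
    case True
    have "0 < \<rho> (v (j - 1)) + \<rho> (v (Suc j))" by (intro add_pos_pos \<rho>)
    then show ?thesis
      using True rat[of j] by (simp add: up_prob_def field_simps)
  qed (use Uz[of j] in \<open>auto simp: up_prob_def\<close>)
  have down: "(1 + U (j - 1) + U j) * (1 - up_prob j) = 1 + U (j - 1)" for j
    using up[of j] by (simp add: algebra_simps)
  have "(if 3 \<le> i then ennreal (visit_vec U $ v (i - 1)) * ennreal (up_prob (i - 1)) else 0) =
      ennreal (U (i - 1))"
  proof (cases "3 \<le> i")
    case True
    then have "ennreal (visit_vec U $ v (i - 1)) * ennreal (up_prob (i - 1)) =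
        ennreal ((1 + U (i - 1 - 1) + U (i - 1)) * up_prob (i - 1))"
      using i up_prob_bounds[of "i - 1"] by (simp add: ennreal_mult'')
    then show ?thesis using True by (simp only: up) simp
  qed (use Uz[of "i - 1"] in auto)
  moreover have "(if i < n then ennreal (visit_vec U $ v (Suc i)) * ennreal (1 - up_prob (Suc i)) else 0) =
      ennreal (if i < n then 1 + U i else 0)"
  proof (cases "i < n")
    case True
    then have "ennreal (visit_vec U $ v (Suc i)) * ennreal (1 - up_prob (Suc i)) =
        ennreal ((1 + U (Suc i - 1) + U (Suc i)) * (1 - up_prob (Suc i)))"
      using i up_prob_bounds[of "Suc i"] by (simp add: ennreal_mult'')
    then show ?thesis using True by (simp only: down) simp
  qed auto
  ultimately have "indicator {v n} y +
      (\<Sum>x\<in>- {v 1}. ennreal (visit_vec U $ x) * ennreal (pmf (rho_step adj \<rho> x) y)) =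
      ennreal (if i = n then 1 else 0) + (ennreal (U (i - 1)) + ennreal (if i < n then 1 + U i else 0))"
    using i n unfolding i(1) by (subst sum_inflow_path) (auto simp: v_eq_iff)
  also have "\<dots> = ennreal (visit_vec U $ y)"
    using i U0[of "i - 1"] U0[of i] Uz[of n] by (subst ennreal_add3) (auto intro: arg_cong[of _ _ ennreal])
  finally show "indicator {v n} y +
      (\<Sum>x\<in>- {v 1}. ennreal (visit_vec U $ x) * ennreal (pmf (rho_step adj \<rho> x) y)) \<le>
      ennreal (visit_vec U $ y)"
    by simp
qed

end

text \<open>The relation between \<open>U\<close> and the weights, solved for the weight with the
  larger index. It links indices two apart, so odd and even positions each have a free initial
  value. The value 1 at vanishing \<open>U (Suc k)\<close>, where no ratio is prescribed, keeps the
  weights positive.\<close>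

fun weights :: "(nat \<Rightarrow> real) \<Rightarrow> nat \<Rightarrow> real" where
  "weights U 0 = 1"
| "weights U (Suc 0) = 1"
| "weights U (Suc (Suc k)) =
    (if 0 < U (Suc k) then weights U k * U (Suc k) / (1 + U k) else 1)"

lemma weights_pos: "(\<And>j. 0 \<le> U j) \<Longrightarrow> 0 < weights U k"
  by (induction U k rule: weights.induct) (auto intro!: divide_pos_pos mult_pos_pos add_pos_nonneg)

lemma weights_ratio:
  assumes "\<And>j. 0 \<le> U j" "0 < U j" "1 \<le> j"
  shows "U j * weights U (j - 1) = (1 + U (j - 1)) * weights U (Suc j)"
proof -
  obtain k where "j = Suc k" using assms(3) by (cases j) auto
  moreover have "0 < 1 + U k" using assms(1)[of k] by simp
  ultimately show ?thesis using assms(2) by (simp add: field_simps)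
qed

lemma solvable_path_iff: "solvable adj (v n) (v 1) r \<longleftrightarrow> r \<in> visit_vec ` pos_crossings"
proof
  assume "solvable adj (v n) (v 1) r"
  then obtain \<rho> where \<rho>: "\<And>x. 0 < \<rho> x"
    and t: "\<And>x. enn2ereal (tau adj (v n) (v 1) \<rho> x) = ereal (r $ x)"
    unfolding solvable_def by blast
  have r0: "0 \<le> r $ x" for x
    using enn2ereal_nonneg[of "tau adj (v n) (v 1) \<rho> x"] unfolding t by simp
  have t': "tau adj (v n) (v 1) \<rho> x = ennreal (r $ x)" for x
    using arg_cong[OF t[of x], of e2ennreal] by (simp add: e2ennreal_ereal)
  obtain U where "U \<in> pos_crossings" "\<And>j. 1 \<le> j \<Longrightarrow> j \<le> n \<Longrightarrow> r $ v j = 1 + U (j - 1) + U j"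
    using tau_path_eq_visit_vec[OF \<rho>, where g = "\<lambda>j. r $ v j", OF t' r0] by blast
  then show "r \<in> visit_vec ` pos_crossings"
    by (intro image_eqI[of _ _ U]) (simp_all add: vec_eq_path_iff)
next
  assume "r \<in> visit_vec ` pos_crossings"
  then obtain U where U: "U \<in> pos_crossings" and r: "r = visit_vec U" by blast
  have U0: "0 \<le> U j" for j
    using U by (cases "j \<in> {2..<n}") (auto simp: pos_crossings_def less_imp_le)
  define \<rho> where "\<rho> x = weights U (idx x)" for x
  have \<rho>: "0 < \<rho> x" for x by (simp add: \<rho>_def weights_pos U0)
  have rat: "U j * \<rho> (v (j - 1)) = (1 + U (j - 1)) * \<rho> (v (Suc j))" if "2 \<le> j" "j < n" for j
    using weights_ratio[of U j] U0 U that by (simp add: \<rho>_def pos_crossings_def)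
  let ?t = "tau adj (v n) (v 1) \<rho>"
  \<comment> \<open>Finiteness has to come first: only then do the balance equations determine
    \<open>tau\<close>.\<close>
  have "?t x < top" for x
    using tau_path_le_visit_vec[OF \<rho> U rat, of x] ennreal_less_top le_less_trans by blast
  then have t: "?t x = ennreal (enn2real (?t x))" for x
    by simp
  obtain V where V: "V \<in> pos_crossings"
    "\<And>j. 1 \<le> j \<Longrightarrow> j \<le> n \<Longrightarrow> enn2real (?t (v j)) = 1 + V (j - 1) + V j"
    "\<And>j. 2 \<le> j \<Longrightarrow> j < n \<Longrightarrow> V j * \<rho> (v (j - 1)) = (1 + V (j - 1)) * \<rho> (v (Suc j))"
    using tau_path_eq_visit_vec[OF \<rho>, where g = "\<lambda>j. enn2real (?t (v j))", OF t enn2real_nonneg]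
    by blast
  \<comment> \<open>Both vectors vanish at 0 and 1 and satisfy the same ratios, which give each
    inner entry from the preceding one.\<close>
  have "V j = U j" for j
  proof (induction j)
    case (Suc j)
    show ?case
    proof (cases "Suc j \<in> {2..<n}")
      case True
      then have "V (Suc j) * \<rho> (v j) = U (Suc j) * \<rho> (v j)"
        using V(3)[of "Suc j"] rat[of "Suc j"] Suc by simp
      then show ?thesis using \<rho>[of "v j"] by simp
    qed (use U V in \<open>auto simp: pos_crossings_def\<close>)
  qed (use U V in \<open>auto simp: pos_crossings_def\<close>)
  then have "enn2real (?t x) = r $ x" for x
    using V(2) r by (cases x rule: vertex_cases) simp
  then have "enn2ereal (?t x) = ereal (r $ x)" for x
    using arg_cong[OF t[of x], of enn2ereal] enn2ereal_ennreal[OF enn2real_nonneg, of "?t x"]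
    by simp
  then show "solvable adj (v n) (v 1) r"
    unfolding solvable_def using \<rho> by blast
qed

end

theorem theorem9:
  fixes adj :: "'v::finite \<Rightarrow> 'v \<Rightarrow> bool"
    and v :: "nat \<Rightarrow> 'v"
    and n :: nat
    and r :: "real ^ 'v"
  assumes "n \<ge> 2"
    and "is_path_graph adj v n"
  shows "solvable adj (v n) (v 1) r \<longleftrightarrow> r \<in> Psi adj (v n) (v 1)"
proof -
  interpret path_graph adj v n
    using assms by unfold_locales
  show ?thesis
    by (simp only: solvable_path_iff Psi_path)
qed

end
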